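(* Let $n\ge 1$, $p\in S^{2n+1}\subset\mathbb{C}^{n+1}$, $v\in T_pS^{2n+1}$, and let $\gamma:\mathbb{R}\to S^{2n+1}$ be the complete sub-Riemannian geodesic $$\gamma(t)=e^{-it\langle v,V_{n+1}(p)\rangle}\,\gamma_R(t),$$ where $\gamma_R$ is the great circle with $\gamma_R(0)=p$ and $\dot\gamma_R(0)=v$. Assume that $\gamma$ is parameterized by arc-length. Then $\gamma$ is closed if and only if $$\frac{\langle v,V_{n+1}(p)\rangle}{\sqrt{1+\langle v,V_{n+1}(p)\rangle^2}}\in\mathbb{Q}.$$
   Context: Identify $\mathbb{C}^{n+1}\cong\mathbb{R}^{2n+2}$ with standard inner product $\langle\cdot,\cdot\rangle$; $S^{2n+1}$ is the unit sphere and $V_{n+1}(p)=i\cdot p$. The sub-Riemannian structure is given by the distribution $\mathcal H=V_{n+1}^{\perp}\subset TS^{2n+1}$ with the restricted metric; the sub-Riemannian geodesics are the curves $\gamma$ of the displayed form. The great circle is $\gamma_R(t)=p\cos(\|v\|t)+\frac{v}{\|v\|}\sin(\|v\|t)$. "Closed" means that $\gamma(T)=\gamma(0)$ for some $T>0$. *)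

theory Defs
  imports "HOL-Analysis.Analysis"
begin

text \<open>
  The space of complex \<open>(n+1)\<close>-vectors is \<open>complex ^ 'k\<close> with \<open>CARD('k) = n + 1\<close>. The library inner
  product on this type is the real one, i.e. the standard inner product of the underlying real
  space of dimension \<open>2n+2\<close>, and \<open>sphere 0 1\<close> is the unit sphere of dimension \<open>2n+1\<close>.
\<close>

definition V :: "complex ^ 'k \<Rightarrow> complex ^ 'k::finite"
  where "V p = \<i> *s p"

definition tangent_sphere :: "complex ^ 'k::finite \<Rightarrow> (complex ^ 'k) set"
  where "tangent_sphere p = {v. v \<bullet> p = 0}"

definition horizontal :: "complex ^ 'k::finite \<Rightarrow> (complex ^ 'k) set"
  where "horizontal p = {v \<in> tangent_sphere p. v \<bullet> V p = 0}"

text \<open>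
  The sub-Riemannian metric is only defined on horizontal vectors, where it is the restriction of the
  inner product. For the curves \<open>sR_geodesic p v\<close> horizontality is automatic; see
  \<open>sR_geodesic_horizontal\<close> below.
\<close>

definition arc_length_parametrized :: "(real \<Rightarrow> complex ^ 'k::finite) \<Rightarrow> bool"
  where "arc_length_parametrized \<gamma> \<longleftrightarrow>
    (\<forall>t. \<exists>D. (\<gamma> has_vector_derivative D) (at t) \<and> D \<in> horizontal (\<gamma> t) \<and> norm D = 1)"

definition great_circle :: "complex ^ 'k::finite \<Rightarrow> complex ^ 'k \<Rightarrow> real \<Rightarrow> complex ^ 'k"
  where "great_circle p v t = cos (norm v * t) *\<^sub>R p + sin (norm v * t) *\<^sub>R (v /\<^sub>R norm v)"

definition sR_geodesic :: "complex ^ 'k::finite \<Rightarrow> complex ^ 'k \<Rightarrow> real \<Rightarrow> complex ^ 'k"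
  where "sR_geodesic p v t = exp (- \<i> * of_real (t * (v \<bullet> V p))) *s great_circle p v t"

definition closed_curve :: "(real \<Rightarrow> 'a) \<Rightarrow> bool"
  where "closed_curve \<gamma> \<longleftrightarrow> (\<exists>T>0. \<gamma> T = \<gamma> 0)"

lemma great_circle_0: "great_circle p v 0 = p"
  by (simp add: great_circle_def)

lemma great_circle_deriv:
  "(great_circle p v has_vector_derivative
     (- (norm v * sin (norm v * t))) *\<^sub>R p + cos (norm v * t) *\<^sub>R v) (at t)"
proof (cases "v = 0")
  case True
  then show ?thesis by (simp add: great_circle_def[abs_def])
next
  case False
  then show ?thesis
    unfolding great_circle_def
    by (auto intro!: derivative_eq_intros simp: field_simps)
qed

lemma great_circle_deriv_0: "(great_circle p v has_vector_derivative v) (at 0)"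
  using great_circle_deriv[of p v 0] by simp

lemma inner_unit_smult:
  fixes x y :: "complex ^ 'k::finite"
  assumes "norm c = 1"
  shows "(c *s x) \<bullet> (c *s y) = x \<bullet> y"
proof -
  have "(c * a) \<bullet> (c * b) = a \<bullet> b" for a b :: complex
  proof -
    have "(c * a) \<bullet> (c * b) = ((Re c)\<^sup>2 + (Im c)\<^sup>2) * (a \<bullet> b)"
      by (simp add: inner_complex_def power2_eq_square algebra_simps)
    with assms show ?thesis by (simp flip: cmod_power2)
  qed
  then show ?thesis
    by (simp add: inner_vec_def)
qed

lemma inner_V_swap: "x \<bullet> V y = - (V x \<bullet> y)"
  by (simp add: V_def inner_vec_def inner_complex_def flip: sum_negf)

lemma inner_V_self: "x \<bullet> V x = 0"
  using inner_V_swap[of x x] by (simp add: inner_commute)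

lemma inner_V_V: "V x \<bullet> V y = x \<bullet> y"
  unfolding V_def by (rule inner_unit_smult) simp

lemma V_lin: "V (x + y) = V x + V y" "V (r *\<^sub>R x) = r *\<^sub>R V x"
  by (simp_all add: V_def vec_eq_iff algebra_simps)

lemma sR_geodesic_horizontal:
  assumes "p \<in> sphere 0 1" "v \<in> tangent_sphere p"
  shows "sR_geodesic p v t \<in> sphere 0 1"
    and "\<exists>D \<in> horizontal (sR_geodesic p v t). (sR_geodesic p v has_vector_derivative D) (at t)"
proof -
  define a where "a = v \<bullet> V p"
  define g where "g = great_circle p v t"
  define g' where "g' = (- (norm v * sin (norm v * t))) *\<^sub>R p + cos (norm v * t) *\<^sub>R v"
  define e where "e = exp (- \<i> * of_real (t * a))"
  define D where "D = e *s (g' - a *\<^sub>R V g)"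
  have ne: "norm e = 1" by (simp add: e_def norm_exp_eq_Re)
  have pp: "p \<bullet> p = 1" using assms(1) by (simp add: dot_square_norm)
  have vp: "v \<bullet> p = 0" "p \<bullet> v = 0"
    using assms(2) by (simp_all add: tangent_sphere_def inner_commute)
  have vv: "v \<bullet> v = norm v * norm v" by (simp add: dot_square_norm power2_eq_square)
  define S where "S = sin (norm v * t)"
  define C where "C = cos (norm v * t)"
  have SC: "C * C + S * S = 1"
    using sin_cos_squared_add2[of "norm v * t"] by (simp add: S_def C_def power2_eq_square)
  define u where "u = v /\<^sub>R norm v"
  have v_u: "v = norm v *\<^sub>R u" by (cases "v = 0") (simp_all add: u_def)
  have up: "u \<bullet> p = 0" "p \<bullet> u = 0" by (simp_all add: u_def vp)
  have nu: "norm v * (u \<bullet> u) = norm v" by (cases "v = 0") (simp_all add: u_def vv field_simps)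
  have gu: "g = C *\<^sub>R p + S *\<^sub>R u"
    by (simp add: g_def great_circle_def S_def C_def u_def)
  have g'u: "g' = norm v *\<^sub>R (C *\<^sub>R u - S *\<^sub>R p)"
    by (simp add: g'_def S_def C_def scaleR_diff_right) (cases "v = 0"; simp add: u_def)
  have gg: "g \<bullet> g = 1"
  proof (cases "v = 0")
    case True
    then show ?thesis by (simp add: gu u_def C_def pp)
  next
    case False
    with nu have "u \<bullet> u = 1" by simp
    then show ?thesis using SC by (simp add: gu inner_add pp up)
  qed
  have "g' \<bullet> g = C * S * (norm v * (u \<bullet> u)) - C * S * norm v"
    by (simp add: gu g'u inner_add inner_diff pp up algebra_simps)
  then have g'g: "g' \<bullet> g = 0" by (simp add: nu)
  have pu: "p \<bullet> V u = - (u \<bullet> V p)"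
    using inner_V_swap[of p u] by (simp add: inner_commute)
  have "g' \<bullet> V g = (C * C + S * S) * (norm v * (u \<bullet> V p))"
    by (simp add: gu g'u inner_add inner_diff V_lin inner_V_self pu algebra_simps)
  also have "norm v * (u \<bullet> V p) = a"
    by (cases "v = 0") (simp_all add: a_def u_def)
  finally have g'V: "g' \<bullet> V g = a" by (simp add: SC)
  have gam: "sR_geodesic p v t = e *s g"
    by (simp add: sR_geodesic_def e_def g_def a_def)
  have "(e *s g) \<bullet> (e *s g) = 1" by (simp only: inner_unit_smult[OF ne] gg)
  then show "sR_geodesic p v t \<in> sphere 0 1"
    by (simp add: gam norm_eq_sqrt_inner)
  have "D \<bullet> (e *s g) = 0"
    unfolding D_def inner_unit_smult[OF ne]
    by (simp add: inner_diff g'g inner_commute[of "V g"] inner_V_self)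
  moreover have "V (e *s g) = e *s V g"
    by (simp add: V_def vec_eq_iff)
  then have "D \<bullet> V (e *s g) = 0"
    by (simp add: D_def inner_unit_smult[OF ne] inner_diff g'V inner_V_V gg)
  ultimately have "D \<in> horizontal (sR_geodesic p v t)"
    by (simp add: horizontal_def tangent_sphere_def gam)
  moreover have "(sR_geodesic p v has_vector_derivative D) (at t)"
  proof -
    have E: "((\<lambda>t. exp (- \<i> * of_real (t * a))) has_vector_derivative (- \<i> * of_real a * e)) (at t)"
    proof -
      have "((\<lambda>z. exp (- \<i> * (z * of_real a))) has_field_derivative (- \<i> * of_real a * e))
          (at (of_real t))"
        unfolding e_def by (auto intro!: derivative_eq_intros)
      from has_vector_derivative_real_field[OF this] show ?thesis
        by simp
    qed
    have G: "((\<lambda>t. great_circle p v t $ i) has_vector_derivative g' $ i) (at t)" for i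
      using bounded_linear.has_vector_derivative[OF bounded_linear_vec_nth great_circle_deriv[of p v t]]
      by (simp add: g'_def)
    have "((\<lambda>t. sR_geodesic p v t $ i) has_vector_derivative D $ i) (at t)" for i
    proof -
      have "sR_geodesic p v t $ i = exp (- \<i> * of_real (t * a)) * great_circle p v t $ i" for t
        by (simp add: sR_geodesic_def a_def)
      moreover have "D $ i = e * g' $ i + (- \<i> * of_real a * e) * great_circle p v t $ i"
      proof -
        have "(a *\<^sub>R V g) $ i = of_real a * (\<i> * g $ i)"
          unfolding vector_scaleR_component by (simp add: V_def scaleR_conv_of_real)
        then show ?thesis
          by (simp only: D_def vector_smult_component vector_minus_component g_def)
            (simp add: algebra_simps)
      qed
      ultimately show ?thesis
        using has_vector_derivative_mult[OF E G[of i]] by (simp add: e_def)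
    qed
    then have "((\<lambda>t. sR_geodesic p v t $ i \<bullet> b) has_vector_derivative D $ i \<bullet> b) (at t)" for i b
      by (rule bounded_linear.has_vector_derivative[OF bounded_linear_inner_left])
    then show ?thesis
      unfolding has_vector_derivative_def
      by (subst has_derivative_componentwise_within) (auto simp: Basis_vec_def inner_axis)
  qed
  ultimately show "\<exists>D \<in> horizontal (sR_geodesic p v t). (sR_geodesic p v has_vector_derivative D) (at t)"
    by blast
qed

end

theory Submission
  imports Defs
begin

text \<open>
  Put \<open>a = \<langle>v, V p\<rangle>\<close>. The velocity at time 0 is \<open>w = v - a V p\<close>, so unit speed
  means \<open>\<parallel>v\<parallel>\<^sup>2 = 1 + a\<^sup>2\<close>, and the unit vector \<open>w\<close> is orthogonal to the complex line through \<open>p\<close>.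
  Pairing \<open>\<gamma>(T) = p\<close> with \<open>w\<close> therefore forces \<open>\<parallel>v\<parallel>T \<in> \<pi>\<int>\<close>, and what remains of the equation
  forces \<open>aT \<in> \<pi>\<int>\<close>; the quotient \<open>a / \<parallel>v\<parallel>\<close> is then rational. Conversely, if this quotient is
  \<open>m / k\<close>, then \<open>T = 2\<pi>k / \<parallel>v\<parallel>\<close> is a period.
\<close>

lemma norm_vector_smult_complex:
  fixes x :: "complex ^ 'k::finite"
  shows "norm (c *s x) = norm c * norm x"
  by (simp add: norm_vec_def L2_set_right_distrib norm_mult)

text \<open>Supplies the product rule for the phase factor times the great circle.\<close>

lemma bounded_bilinear_vector_smult:
  "bounded_bilinear (\<lambda>c (x :: complex ^ 'k::finite). c *s x)"
proof
  show "\<exists>K. \<forall>c (x :: complex ^ 'k). norm (c *s x) \<le> norm c * norm x * K"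
    by (rule exI[of _ 1]) (simp add: norm_vector_smult_complex)
qed (simp_all add: vec_eq_iff algebra_simps)

text \<open>Exhibits the complex line through \<open>x\<close> as the real span of \<open>x\<close>
  and \<open>V x\<close>, which makes it accessible to the real inner product.\<close>

lemma vector_smult_Re_Im: "c *s x = Re c *\<^sub>R x + Im c *\<^sub>R V x"
proof -
  have "c * y = Re c *\<^sub>R y + Im c *\<^sub>R (\<i> * y)" for y
    by (simp add: complex_eq_iff)
  then show ?thesis
    by (simp add: V_def vec_eq_iff)
qed

lemma vector_smult_of_real: "of_real r *s x = r *\<^sub>R (x :: complex ^ 'k::finite)"
  by (simp add: vector_smult_Re_Im)

lemma sR_geodesic_0: "sR_geodesic p v 0 = p"
  by (simp add: sR_geodesic_def great_circle_0)

lemma sR_geodesic_deriv_0: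
  "(sR_geodesic p v has_vector_derivative v - (v \<bullet> V p) *\<^sub>R V p) (at 0)"
proof -
  define a where "a = v \<bullet> V p"
  have "((\<lambda>z. exp (- \<i> * (z * of_real a))) has_field_derivative (- \<i> * of_real a)) (at (of_real 0))"
    by (auto intro!: derivative_eq_intros)
  from has_vector_derivative_real_field[OF this]
  have "((\<lambda>t. exp (- \<i> * of_real (t * a))) has_vector_derivative - \<i> * of_real a) (at 0)"
    by simp
  from bounded_bilinear.has_vector_derivative
    [OF bounded_bilinear_vector_smult this great_circle_deriv_0[of p v]]
  show ?thesis
    by (simp add: sR_geodesic_def[abs_def] great_circle_0 vector_smult_Re_Im a_def)
qed

text \<open>Derivatives are unique, so the unit velocity at time 0 is the vector computed in
  \<open>sR_geodesic_deriv_0\<close>.\<close>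

lemma arc_length_sR_geodesic:
  assumes "arc_length_parametrized (sR_geodesic p v)"
  shows "norm (v - (v \<bullet> V p) *\<^sub>R V p) = 1"
  using assms vector_derivative_unique_at[OF sR_geodesic_deriv_0]
  unfolding arc_length_parametrized_def by metis

theorem proposition5:
  fixes n :: nat and p v :: "complex ^ 'k::finite"
  assumes "n \<ge> 1" and "CARD('k) = n + 1"
    and "p \<in> sphere 0 1" and "v \<in> tangent_sphere p"
    and "arc_length_parametrized (sR_geodesic p v)"
  shows "closed_curve (sR_geodesic p v) \<longleftrightarrow>
    (v \<bullet> V p) / sqrt (1 + (v \<bullet> V p)\<^sup>2) \<in> \<rat>"
proof -
  define a where "a = v \<bullet> V p"
  define w where "w = v - a *\<^sub>R V p"
  have pp: "p \<bullet> p = 1" using assms(3) by (simp add: dot_square_norm)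
  have vp: "v \<bullet> p = 0" using assms(4) by (simp add: tangent_sphere_def)
  have ww: "w \<bullet> w = 1"
    using arc_length_sR_geodesic[OF assms(5)] by (simp add: w_def a_def dot_square_norm)
  have wp: "w \<bullet> p = 0"
    by (simp add: w_def inner_diff vp inner_commute[of "V p"] inner_V_self)
  have wV: "w \<bullet> V p = 0"
    by (simp add: w_def inner_diff inner_V_V pp flip: a_def)
  have v_w: "v = w + a *\<^sub>R V p" by (simp add: w_def)
  have wv: "w \<bullet> v = 1" by (simp add: v_w inner_add wV ww)
  have "v \<bullet> v = 1 + a\<^sup>2"
    by (simp add: v_w inner_add wV ww inner_V_V pp inner_commute[of "V p"] power2_eq_square)
  then have nv: "norm v = sqrt (1 + a\<^sup>2)"
    by (simp add: norm_eq_sqrt_inner)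
  then have nv_pos: "norm v > 0"
    by (simp add: add_pos_nonneg)
  have p0: "p \<noteq> 0" using pp by auto
  have "closed_curve (sR_geodesic p v) \<longleftrightarrow> a / norm v \<in> \<rat>"
  proof
    assume "closed_curve (sR_geodesic p v)"
    then obtain T where T: "T > 0" "sR_geodesic p v T = p"
      by (auto simp: closed_curve_def sR_geodesic_0)
    define e where "e = exp (- \<i> * of_real (T * a))"
    have eg: "e *s great_circle p v T = p"
      using T(2) by (simp add: sR_geodesic_def e_def a_def)
    \<comment> \<open>Undoing the phase places the great circle point in the complex line through
      \<open>p\<close>.\<close>
    have "great_circle p v T = inverse e *s (e *s great_circle p v T)"
      by (simp add: e_def)
    then have "great_circle p v T = inverse e *s p"
      by (simp only: eg)
    then have "w \<bullet> great_circle p v T = 0"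
      by (simp add: vector_smult_Re_Im inner_add inner_diff wp wV)
    \<comment> \<open>As \<open>w\<close> is orthogonal to \<open>p\<close> and \<open>wv\<close>
      holds, the pairing equals \<open>sin (norm v * T) / norm v\<close>.\<close>
    then have sin0: "sin (norm v * T) = 0"
      using nv_pos by (auto simp: great_circle_def inner_add wp wv)
    then obtain k :: int where k: "norm v * T = of_int k * pi"
      by (auto simp: sin_zero_iff_int2)
    have cos0: "cos (norm v * T) \<noteq> 0"
      using sin_cos_squared_add[of "norm v * T"] sin0 by auto
    have "(e * of_real (cos (norm v * T))) *s p = 1 *s p"
      using eg by (simp add: great_circle_def sin0 flip: vector_smult_of_real)
    then have "e * of_real (cos (norm v * T)) = 1"
      using p0 by (simp only: vector_mul_rcancel) simp
    \<comment> \<open>The cosine is real and nonzero, so the phase \<open>e\<close> itself must be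
      real.\<close>
    then have "Im (e * of_real (cos (norm v * T))) = 0" by simp
    then have "sin (T * a) = 0"
      using cos0 by (simp add: e_def Im_exp)
    then obtain m :: int where m: "T * a = of_int m * pi"
      by (auto simp: sin_zero_iff_int2)
    have "a / norm v = (T * a) / (norm v * T)"
      using T(1) by simp
    also have "\<dots> = of_int m / of_int k"
      by (simp add: k m)
    finally show "a / norm v \<in> \<rat>" by simp
  next
    assume "a / norm v \<in> \<rat>"
    then obtain m k :: int where k: "k > 0" and mk: "a / norm v = of_int m / of_int k"
      by (elim Rats_cases') blast
    \<comment> \<open>The factor 2 avoids signs: the great circle makes \<open>k\<close> full turns
      and the phase \<open>m\<close>, whatever their parities.\<close>
    define T where "T = 2 * pi * of_int k / norm v"
    have "norm v * T = 2 * pi * of_int k"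
      using nv_pos by (simp add: T_def)
    then have gc: "great_circle p v T = p"
      by (simp add: great_circle_def cos_int_2pin sin_int_2pin)
    have "T * a = 2 * pi * of_int k * (a / norm v)"
      by (simp add: T_def)
    also have "\<dots> = 2 * pi * of_int m"
      using k by (simp add: mk)
    finally have "exp (- \<i> * of_real (T * a)) = 1"
      by (simp add: complex_eq_iff Re_exp Im_exp cos_int_2pin sin_int_2pin)
    then have "sR_geodesic p v T = p"
      by (simp add: sR_geodesic_def gc flip: a_def)
    moreover have "T > 0"
      using k nv_pos by (simp add: T_def)
    ultimately show "closed_curve (sR_geodesic p v)"
      by (auto simp: closed_curve_def sR_geodesic_0)
  qed
  then show ?thesis
    by (simp add: nv a_def)
qed

end
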